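(* Let data points $\{(x^\ell,y_\ell)\}_{\ell=1}^N\subset\mathbb{R}^d\times\mathbb{R}$ be given, let $k_1,k_2$ be positive integers, and let $X\subseteq\mathbb{R}^{(k_1+k_2)(d+1)}$ be a nonempty polyhedral set. Consider the least-squares piecewise affine regression problem $$\min_{\Theta\in X}\; f(\Theta)=\frac{1}{2N}\sum_{\ell=1}^N\left(y_\ell-\left[\max_{1\le i\le k_1}\left((a^i)^Tx^\ell+\alpha_i\right)-\max_{1\le i\le k_2}\left((b^i)^Tx^\ell+\beta_i\right)\right]\right)^2$$ in the variable $\Theta=\left\{(a^i,\alpha_i)_{i=1}^{k_1},(b^i,\beta_i)_{i=1}^{k_2}\right\}\in\mathbb{R}^{(k_1+k_2)(d+1)}$, with $a^i,b^i\in\mathbb{R}^d$ and $\alpha_i,\beta_i\in\mathbb{R}$. The following statements hold for this problem: (a) It attains a finite globally minimum value. (b) The set of d-stationary values is finite. (c) Every d-stationary point is a local minimizer.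
   Context: A polyhedral set is the solution set of finitely many (non-strict) linear inequalities. With $f'(\bar\Theta;v)=\lim_{\delta\downarrow0}\frac{f(\bar\Theta+\delta v)-f(\bar\Theta)}{\delta}$, a point $\bar\Theta\in X$ is a d-stationary point of $\min_{\Theta\in X}f(\Theta)$ if $f'(\bar\Theta;\Theta-\bar\Theta)\ge0$ for all $\Theta\in X$; the d-stationary values are the numbers $f(\bar\Theta)$ at d-stationary points $\bar\Theta$. A local minimizer means a local minimizer of $f$ over $X$. *)

theory Defs
  imports "HOL-Analysis.Analysis"
begin

text \<open>The variable \<open>\<Theta> = ((a\<^sup>i, \<alpha>\<^sub>i)\<^sub>i, (b\<^sup>i, \<beta>\<^sub>i)\<^sub>i)\<close> of the regression problem, with
  \<open>d = CARD('d)\<close>, \<open>k\<^sub>1 = CARD('k1)\<close>, \<open>k\<^sub>2 = CARD('k2)\<close>. With the library instances this is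
  a Euclidean space of dimension \<open>(k\<^sub>1 + k\<^sub>2) (d + 1)\<close> carrying the standard inner product.\<close>

type_synonym ('d, 'k1, 'k2) pa_params = "(((real ^ 'd) \<times> real) ^ 'k1) \<times> (((real ^ 'd) \<times> real) ^ 'k2)"

definition max_affine :: "((real ^ 'd) \<times> real) ^ 'k \<Rightarrow> real ^ 'd \<Rightarrow> real" where
  "max_affine c u = (MAX i. fst (c $ i) \<bullet> u + snd (c $ i))"

definition pa_loss ::
  "nat \<Rightarrow> (nat \<Rightarrow> real ^ 'd::finite) \<Rightarrow> (nat \<Rightarrow> real) \<Rightarrow> ('d::finite, 'k1::finite, 'k2::finite) pa_params \<Rightarrow> real" where
  "pa_loss N x y \<Theta> =
     1 / (2 * real N) *
       (\<Sum>l = 1..N. (y l - (max_affine (fst \<Theta>) (x l) - max_affine (snd \<Theta>) (x l)))\<^sup>2)"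

definition has_dir_derivative :: "('a::real_normed_vector \<Rightarrow> real) \<Rightarrow> 'a \<Rightarrow> 'a \<Rightarrow> real \<Rightarrow> bool" where
  "has_dir_derivative f p v D \<longleftrightarrow>
     ((\<lambda>\<delta>. (f (p + \<delta> *\<^sub>R v) - f p) / \<delta>) \<longlongrightarrow> D) (at_right 0)"

definition d_stationary :: "('a::real_normed_vector \<Rightarrow> real) \<Rightarrow> 'a set \<Rightarrow> 'a \<Rightarrow> bool" where
  "d_stationary f X p \<longleftrightarrow>
     p \<in> X \<and> (\<forall>q\<in>X. \<exists>D. has_dir_derivative f p (q - p) D \<and> D \<ge> 0)"

definition local_minimizer :: "('a::metric_space \<Rightarrow> real) \<Rightarrow> 'a set \<Rightarrow> 'a \<Rightarrow> bool" where
  "local_minimizer f X p \<longleftrightarrow>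
     p \<in> X \<and> (\<exists>e>0. \<forall>q\<in>X. dist q p < e \<longrightarrow> f p \<le> f q)"

end

theory Submission
  imports Defs
begin

text \<open>
  The model value at a sample is a maximum of linear functions of \<open>\<Theta>\<close> minus another such maximum.
  Choosing, for every sample, one index that attains each of the two maxima splits \<open>X\<close> into
  finitely many polyhedral cells (\<open>active_cell\<close>). On one cell both maxima are linear in \<open>\<Theta>\<close>, so the
  loss coincides there with a linear least-squares objective, which is convex. The three claims
  follow from this picture; the cells overlap along their boundaries, and that is what makes (c) work.

  For (b) and (c): a d-stationary point is, by convexity along segments inside a cell, a minimizer
  of the loss over each cell that contains it (\<open>d_stationary_minimizes_on_convex_piece\<close>). Hence a
  d-stationary value is the minimum of the loss over one of finitely many cells, which proves (b). A
  d-stationary point has positive distance to the cells not containing it, because these are closed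
  and finitely many. So all nearby points of \<open>X\<close> lie in cells over which it is a minimizer, which
  proves (c).

  For (a) it suffices that linear least squares attains its minimum on a nonempty polyhedron, a case
  of the Frank--Wolfe theorem. On affine sets this follows from solvability of the normal
  equations (\<open>least_squares_attains_on_affine\<close>). The passage from affine sets to polyhedra
  (\<open>convex_attains_on_polyhedron\<close>) is an active-set argument: any feasible point can be
  replaced, without increasing the objective, by a feasible point that minimizes the objective
  over the affine set cut out by its own active constraints. Only finitely many
  values arise from such points, one for each set of active constraints, so a least one exists.
\<close>

section \<open>Minimizers over finitely many sets\<close>

definition minimizes_on :: "('a \<Rightarrow> real) \<Rightarrow> 'a set \<Rightarrow> 'a \<Rightarrow> bool" where
  "minimizes_on f A p \<longleftrightarrow> p \<in> A \<and> (\<forall>q\<in>A. f p \<le> f q)"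

text \<open>Minimizers over the same set share their value, so there is at most one value per set.\<close>

lemma finite_minimum_values:
  assumes "finite I"
  shows "finite {f p | p. \<exists>i\<in>I. minimizes_on f (A i) p}"
proof (rule finite_subset)
  show "{f p | p. \<exists>i\<in>I. minimizes_on f (A i) p} \<subseteq> (\<lambda>i. Inf (f ` A i)) ` I"
  proof clarify
    fix p i assume "i \<in> I" and p: "minimizes_on f (A i) p"
    have "Inf (f ` A i) = f p"
      using p by (intro cInf_eq_minimum) (auto simp: minimizes_on_def)
    then show "f p \<in> (\<lambda>i. Inf (f ` A i)) ` I"
      using \<open>i \<in> I\<close> by force
  qed
qed (simp add: assms)

text \<open>A function has a minimizer as soon as every point is dominated by one whose value lies in a
  finite set.\<close>

lemma attains_min_if_dominated_by_finite:
  fixes f :: "'a \<Rightarrow> real"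
  assumes "A \<noteq> {}" and "finite (f ` B)" and "B \<subseteq> A"
    and dom: "\<And>p. p \<in> A \<Longrightarrow> \<exists>q\<in>B. f q \<le> f p"
  shows "\<exists>p. minimizes_on f A p"
proof -
  have "f ` B \<noteq> {}" using assms(1) dom by blast
  then obtain q where q: "q \<in> B" "f q = Min (f ` B)"
    using Min_in[OF \<open>finite (f ` B)\<close>] by (metis imageE)
  have "f q \<le> f p" if p: "p \<in> A" for p
  proof -
    obtain r where "r \<in> B" "f r \<le> f p" using dom[OF p] by blast
    moreover have "f q \<le> f r" using q \<open>r \<in> B\<close> assms(2) by simp
    ultimately show ?thesis by simp
  qed
  then show ?thesis using q assms(3) by (auto simp: minimizes_on_def)
qed

section \<open>From affine sets to polyhedra\<close>

text \<open>The active-set argument. From a feasible point, move towards a minimizer over the affine set cut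
  out by its active constraints. Convexity keeps the objective from increasing. Either the whole
  segment is feasible, or it leaves the polyhedron at a point where one more constraint has become
  active; the latter can happen only finitely often.\<close>

lemma dominated_by_active_set_minimizer:
  fixes q :: "'a::euclidean_space \<Rightarrow> real" and a :: "'i \<Rightarrow> 'a" and b :: "'i \<Rightarrow> real"
  assumes "finite F" and conv: "convex_on UNIV q"
    and att: "\<And>L. affine L \<Longrightarrow> L \<noteq> {} \<Longrightarrow> \<exists>p. minimizes_on q L p"
  defines "P \<equiv> {p. \<forall>h\<in>F. a h \<bullet> p \<le> b h}"
    and "L \<equiv> \<lambda>J. {p. \<forall>h\<in>J. a h \<bullet> p = b h}"
    and "act \<equiv> \<lambda>p. {h\<in>F. a h \<bullet> p = b h}"
  assumes "p \<in> P"
  shows "\<exists>p'\<in>P. q p' \<le> q p \<and> minimizes_on q (L (act p')) p'"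
  using \<open>p \<in> P\<close>
proof (induction "card (F - act p)" arbitrary: p rule: less_induct)
  case less
  have affL: "affine (L J)" for J
  proof -
    have "L J = (\<Inter>h\<in>J. {p. a h \<bullet> p = b h})" by (auto simp: L_def)
    then show ?thesis by (auto intro: affine_hyperplane)
  qed
  have pL: "p \<in> L (act p)" by (auto simp: L_def act_def)
  then obtain m where m: "minimizes_on q (L (act p)) m"
    using att[OF affL] by blast
  have qm: "q m \<le> q p" using m pL by (auto simp: minimizes_on_def)
  have mL: "a h \<bullet> m = b h" if "h \<in> act p" for h
    using m that by (auto simp: minimizes_on_def L_def)
  show ?case
  proof (cases "m \<in> P")
    case True
    have "act p \<subseteq> act m" using mL by (auto simp: act_def)
    then have "L (act m) \<subseteq> L (act p)" by (auto simp: L_def)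
    moreover have "m \<in> L (act m)" by (auto simp: L_def act_def)
    ultimately have "minimizes_on q (L (act m)) m" using m by (auto simp: minimizes_on_def)
    then show ?thesis using True qm by blast
  next
    case False
    \<comment> \<open>\<open>r h\<close> is the fraction of the way from \<open>p\<close> to \<open>m\<close> at which constraint \<open>h\<close> becomes tight.\<close>
    define V where "V = {h\<in>F. b h < a h \<bullet> m}"
    define r where "r h = (b h - a h \<bullet> p) / (a h \<bullet> m - a h \<bullet> p)" for h
    have "finite V" "V \<noteq> {}" using False \<open>finite F\<close> by (auto simp: V_def P_def not_le)
    then obtain k where k: "k \<in> V" and kmin: "\<And>h. h \<in> V \<Longrightarrow> r k \<le> r h"
      using ex_min_if_finite[of "r ` V"] by (metis (no_types, lifting) finite_imageI image_iff image_is_empty linorder_not_less)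
    define t where "t = r k"
    define p1 where "p1 = (1 - t) *\<^sub>R p + t *\<^sub>R m"
    have pP: "a h \<bullet> p \<le> b h" if "h \<in> F" for h using less.prems that by (auto simp: P_def)
    have pk: "a k \<bullet> p \<le> b k" "b k < a k \<bullet> m" using k pP by (auto simp: V_def)
    have t01: "0 \<le> t" "t \<le> 1" using pk by (auto simp: t_def r_def divide_simps)
    have a1: "a h \<bullet> p1 = a h \<bullet> p + t * (a h \<bullet> m - a h \<bullet> p)" for h
      by (simp add: p1_def inner_add_right algebra_simps)
    have p1P: "a h \<bullet> p1 \<le> b h" if h: "h \<in> F" for h
    proof (cases "h \<in> V")
      case True
      then have pos: "0 < a h \<bullet> m - a h \<bullet> p" using pP[OF h] by (auto simp: V_def)
      have "t * (a h \<bullet> m - a h \<bullet> p) \<le> r h * (a h \<bullet> m - a h \<bullet> p)"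
        using kmin[OF True] pos by (simp add: t_def)
      also have "\<dots> = b h - a h \<bullet> p" using pos by (simp add: r_def)
      finally show ?thesis by (simp add: a1)
    next
      case False
      then have "a h \<bullet> m \<le> b h" using h by (auto simp: V_def)
      then have "(1 - t) * (a h \<bullet> p) + t * (a h \<bullet> m) \<le> b h"
        using pP[OF h] t01 by (intro convex_bound_le) auto
      then show ?thesis by (simp add: a1 algebra_simps)
    qed
    then have "p1 \<in> P" by (simp add: P_def)
    have "k \<in> act p1" using pk k by (simp add: act_def V_def a1 t_def r_def)
    moreover have "k \<notin> act p" using mL[of k] pk by auto
    moreover have "act p \<subseteq> act p1" using mL by (auto simp: act_def a1)
    moreover have "act p1 \<subseteq> F" by (auto simp: act_def)
    ultimately have "F - act p1 \<subset> F - act p" by blast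
    then have "card (F - act p1) < card (F - act p)"
      using \<open>finite F\<close> by (simp add: psubset_card_mono)
    from less.hyps[OF this \<open>p1 \<in> P\<close>] obtain p'
      where p': "p' \<in> P" "q p' \<le> q p1" "minimizes_on q (L (act p')) p'" by blast
    have "q p1 \<le> (1 - t) * q p + t * q m"
      unfolding p1_def using t01 by (intro convex_onD[OF conv]) auto
    also have "\<dots> \<le> q p" using qm t01 by (intro convex_bound_le) auto
    finally show ?thesis using p' by (intro bexI[of _ p'] conjI) auto
  qed
qed

lemma convex_attains_on_polyhedron:
  fixes q :: "'a::euclidean_space \<Rightarrow> real"
  assumes "polyhedron P" "P \<noteq> {}" and conv: "convex_on UNIV q"
    and att: "\<And>L. affine L \<Longrightarrow> L \<noteq> {} \<Longrightarrow> \<exists>p. minimizes_on q L p"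
  shows "\<exists>p. minimizes_on q P p"
proof -
  obtain F where F: "finite F" "P = \<Inter>F" "\<forall>h\<in>F. \<exists>a b. a \<noteq> 0 \<and> h = {x. a \<bullet> x \<le> b}"
    using assms(1) unfolding polyhedron_def by blast
  then obtain a b where ab: "\<And>h. h \<in> F \<Longrightarrow> h = {x. a h \<bullet> x \<le> b h}" by metis
  have P: "P = {p. \<forall>h\<in>F. a h \<bullet> p \<le> b h}" using F(2) ab by blast
  define L where "L J = {p. \<forall>h\<in>J. a h \<bullet> p = b h}" for J
  define act where "act p = {h\<in>F. a h \<bullet> p = b h}" for p
  define B where "B = {p\<in>P. minimizes_on q (L (act p)) p}"
  have "q ` B \<subseteq> {q p | p. \<exists>J\<in>Pow F. minimizes_on q (L J) p}"
  proof clarify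
    fix p assume "p \<in> B"
    moreover have "act p \<in> Pow F" by (auto simp: act_def)
    ultimately show "\<exists>p'. q p = q p' \<and> (\<exists>J\<in>Pow F. minimizes_on q (L J) p')"
      by (auto simp: B_def)
  qed
  then have "finite (q ` B)"
    by (rule finite_subset) (simp add: finite_minimum_values F(1))
  moreover have "\<exists>p'\<in>B. q p' \<le> q p" if "p \<in> P" for p
    using dominated_by_active_set_minimizer[OF F(1) conv att, of p a b] that
    unfolding P B_def L_def act_def by blast
  ultimately show ?thesis
    using assms(2) by (intro attains_min_if_dominated_by_finite[of P q B]) (auto simp: B_def)
qed

section \<open>Linear least squares\<close>

text \<open>Solvability of the normal equations: the part of the right-hand side orthogonal to the range of
  the Gram operator \<open>u \<mapsto> (\<Sum>l\<in>M. (h l \<bullet> u) *\<^sub>R h l)\<close> is orthogonal to every \<open>h l\<close>, hence to the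
  right-hand side itself, hence zero.\<close>

lemma normal_equations_solvable:
  fixes h :: "'i \<Rightarrow> 'a::euclidean_space" and y :: "'i \<Rightarrow> real"
  assumes "finite M"
  obtains u where "(\<Sum>l\<in>M. (y l - h l \<bullet> u) *\<^sub>R h l) = 0"
proof -
  define G where "G u = (\<Sum>l\<in>M. (h l \<bullet> u) *\<^sub>R h l)" for u
  define b where "b = (\<Sum>l\<in>M. y l *\<^sub>R h l)"
  have "linear G"
    unfolding G_def by (intro linearI) (simp_all add: inner_add_right scaleR_add_left sum.distrib scaleR_right.sum)
  then have sub: "subspace (range G)" by (simp add: linear_subspace_image)
  obtain g w where gw: "g \<in> span (range G)" "\<And>v. v \<in> span (range G) \<Longrightarrow> orthogonal w v" "b = g + w"
    using orthogonal_subspace_decomp_exists[of "range G" b] by blast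
  then have g: "g \<in> range G" and w: "\<And>v. w \<bullet> G v = 0"
    using sub by (auto simp: span_eq_iff[THEN iffD2] orthogonal_def)
  have "(\<Sum>l\<in>M. (h l \<bullet> w)\<^sup>2) = w \<bullet> G w"
    by (simp add: G_def inner_sum_right power2_eq_square inner_commute)
  then have hw: "\<forall>l\<in>M. h l \<bullet> w = 0"
    using w[of w] assms by (simp add: sum_nonneg_eq_0_iff)
  have "w \<bullet> b = 0" using hw by (simp add: b_def inner_sum_right inner_commute)
  moreover have "w \<bullet> g = 0" using g w by auto
  ultimately have "w = 0" using gw(3) by (simp add: inner_add_right)
  then obtain u where "b = G u" using g gw(3) by auto
  then have "(\<Sum>l\<in>M. (y l - h l \<bullet> u) *\<^sub>R h l) = 0"
    by (simp add: b_def G_def scaleR_diff_left sum_subtractf)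
  then show ?thesis by (rule that)
qed

definition least_squares :: "real \<Rightarrow> 'i set \<Rightarrow> ('i \<Rightarrow> real) \<Rightarrow> ('i \<Rightarrow> 'a::real_inner) \<Rightarrow> 'a \<Rightarrow> real" where
  "least_squares c M y h u = c * (\<Sum>l\<in>M. (y l - h l \<bullet> u)\<^sup>2)"

lemma least_squares_attains_on_UNIV:
  fixes h :: "'i \<Rightarrow> 'a::euclidean_space"
  assumes "finite M" "0 \<le> c"
  shows "\<exists>u. \<forall>v. least_squares c M y h u \<le> least_squares c M y h v"
proof -
  obtain u where u: "(\<Sum>l\<in>M. (y l - h l \<bullet> u) *\<^sub>R h l) = 0"
    using normal_equations_solvable[OF assms(1)] by blast
  have "(\<Sum>l\<in>M. (y l - h l \<bullet> u)\<^sup>2) \<le> (\<Sum>l\<in>M. (y l - h l \<bullet> v)\<^sup>2)" for v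
  proof -
    have "(\<Sum>l\<in>M. (y l - h l \<bullet> u) * (h l \<bullet> (v - u))) = (\<Sum>l\<in>M. (y l - h l \<bullet> u) *\<^sub>R h l) \<bullet> (v - u)"
      by (simp add: inner_sum_left)
    then have cross: "(\<Sum>l\<in>M. (y l - h l \<bullet> u) * (h l \<bullet> (v - u))) = 0" by (simp add: u)
    have "(\<Sum>l\<in>M. (y l - h l \<bullet> v)\<^sup>2) =
        (\<Sum>l\<in>M. (y l - h l \<bullet> u)\<^sup>2 - 2 * ((y l - h l \<bullet> u) * (h l \<bullet> (v - u))) + (h l \<bullet> (v - u))\<^sup>2)"
      by (intro sum.cong) (auto simp: inner_diff_right power2_eq_square algebra_simps)
    also have "\<dots> = (\<Sum>l\<in>M. (y l - h l \<bullet> u)\<^sup>2) + (\<Sum>l\<in>M. (h l \<bullet> (v - u))\<^sup>2)"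
      by (simp only: sum.distrib sum_subtractf sum_distrib_left[symmetric] cross)
    finally show ?thesis by (simp add: sum_nonneg)
  qed
  then show ?thesis
    using assms(2) by (auto simp: least_squares_def intro!: exI[of _ u] mult_left_mono)
qed

text \<open>On a translate \<open>p + U\<close> of a subspace the functionals \<open>h l\<close> may be replaced by their orthogonal
  projections onto \<open>U\<close>, up to constants that are absorbed into the data. The projections ignore the component of the variable orthogonal to \<open>U\<close>, so an
  unconstrained minimizer can be projected back into \<open>U\<close>.\<close>

lemma least_squares_attains_on_affine:
  fixes h :: "'i \<Rightarrow> 'a::euclidean_space"
  assumes "finite M" "0 \<le> c" "affine L" "L \<noteq> {}"
  shows "\<exists>u. minimizes_on (least_squares c M y h) L u"
proof -
  obtain p where p: "p \<in> L" using assms by blast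
  define U where "U = (\<lambda>z. z - p) ` L"
  have U: "subspace U" using affine_diffs_subspace_subtract[OF assms(3) p] by (simp add: U_def)
  have decomp: "\<exists>z. z \<in> U \<and> (\<forall>v\<in>U. (u - z) \<bullet> v = 0)" for u
  proof -
    obtain z w where "z \<in> span U" "\<And>v. v \<in> span U \<Longrightarrow> orthogonal w v" "u = z + w"
      using orthogonal_subspace_decomp_exists[of U u] by blast
    then show ?thesis using U
      by (intro exI[of _ z]) (auto simp: span_eq_iff[THEN iffD2] orthogonal_def)
  qed
  then obtain \<pi> where \<pi>: "\<And>u. \<pi> u \<in> U" "\<And>u v. v \<in> U \<Longrightarrow> (u - \<pi> u) \<bullet> v = 0" by metis
  define y' where "y' l = y l - h l \<bullet> p" for l
  have shift: "least_squares c M y h (p + v) = least_squares c M y' (\<lambda>l. \<pi> (h l)) v" if "v \<in> U" for v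
  proof -
    have "h l \<bullet> v = \<pi> (h l) \<bullet> v" for l using \<pi>(2)[OF that, of "h l"] by (simp add: inner_diff_left)
    then show ?thesis by (simp add: least_squares_def y'_def inner_add_right diff_diff_eq)
  qed
  obtain u where u: "\<And>v. least_squares c M y' (\<lambda>l. \<pi> (h l)) u \<le> least_squares c M y' (\<lambda>l. \<pi> (h l)) v"
    using least_squares_attains_on_UNIV[OF assms(1,2)] by blast
  have "\<pi> (h l) \<bullet> u = \<pi> (h l) \<bullet> \<pi> u" for l
    using \<pi>(2)[OF \<pi>(1), of u "h l"] by (simp add: inner_diff_left inner_diff_right inner_commute)
  then have "least_squares c M y' (\<lambda>l. \<pi> (h l)) u = least_squares c M y' (\<lambda>l. \<pi> (h l)) (\<pi> u)"
    by (simp add: least_squares_def)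
  with u have "least_squares c M y h (p + \<pi> u) \<le> least_squares c M y h (p + v)" if "v \<in> U" for v
    using that by (simp add: shift \<pi>(1))
  moreover have "p + \<pi> u \<in> L" using \<pi>(1)[of u] by (auto simp: U_def)
  moreover have "\<exists>v\<in>U. z = p + v" if "z \<in> L" for z using that by (force simp: U_def)
  ultimately have "minimizes_on (least_squares c M y h) L (p + \<pi> u)"
    unfolding minimizes_on_def by metis
  then show ?thesis by blast
qed

lemma convex_on_least_squares:
  assumes "0 \<le> c"
  shows "convex_on UNIV (least_squares c M y h)"
proof -
  have "(y l - h l \<bullet> ((1 - t) *\<^sub>R u + t *\<^sub>R v))\<^sup>2
      \<le> (1 - t) * (y l - h l \<bullet> u)\<^sup>2 + t * (y l - h l \<bullet> v)\<^sup>2" if "0 < t" "t < 1" for t u v l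
  proof -
    \<comment> \<open>The gap in Jensen's inequality for the square is \<open>t (1 - t)\<close> times a square.\<close>
    have "(1 - t) * (y l - h l \<bullet> u)\<^sup>2 + t * (y l - h l \<bullet> v)\<^sup>2
        - (y l - h l \<bullet> ((1 - t) *\<^sub>R u + t *\<^sub>R v))\<^sup>2 = t * (1 - t) * (h l \<bullet> u - h l \<bullet> v)\<^sup>2"
      by (simp add: inner_add_right power2_eq_square algebra_simps)
    moreover have "0 \<le> t * (1 - t) * (h l \<bullet> u - h l \<bullet> v)\<^sup>2" using that by simp
    ultimately show ?thesis by linarith
  qed
  then have "convex_on UNIV (\<lambda>u. \<Sum>l\<in>M. (y l - h l \<bullet> u)\<^sup>2)"
    by (intro convex_onI) (auto simp: sum_distrib_left sum.distrib[symmetric] intro!: sum_mono)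
  then have "convex_on UNIV (\<lambda>u. c * (\<Sum>l\<in>M. (y l - h l \<bullet> u)\<^sup>2))"
    using assms by (rule convex_on_cmul[rotated])
  then show ?thesis by (simp add: least_squares_def[abs_def])
qed

section \<open>Stationarity on finitely many convex pieces\<close>

text \<open>On a convex piece the difference quotient towards \<open>q\<close> is at most \<open>f q - f p\<close>, so its
  nonnegative limit is, too.\<close>

lemma d_stationary_minimizes_on_convex_piece:
  assumes stat: "d_stationary f X p" and "C \<subseteq> X" "p \<in> C" and conv: "convex_on C f"
  shows "minimizes_on f C p"
  unfolding minimizes_on_def
proof (intro conjI ballI)
  fix q assume q: "q \<in> C"
  then obtain D where D: "((\<lambda>\<delta>. (f (p + \<delta> *\<^sub>R (q - p)) - f p) / \<delta>) \<longlongrightarrow> D) (at_right 0)" "D \<ge> 0"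
    using stat \<open>C \<subseteq> X\<close> unfolding d_stationary_def has_dir_derivative_def by blast
  have "eventually (\<lambda>\<delta>. \<delta> \<in> {0<..<1::real}) (at_right 0)"
    by (rule eventually_at_right_real) simp
  then have "eventually (\<lambda>\<delta>. (f (p + \<delta> *\<^sub>R (q - p)) - f p) / \<delta> \<le> f q - f p) (at_right 0)"
  proof eventually_elim
    case (elim \<delta>)
    have "f ((1 - \<delta>) *\<^sub>R p + \<delta> *\<^sub>R q) \<le> (1 - \<delta>) * f p + \<delta> * f q"
      using elim q \<open>p \<in> C\<close> by (intro convex_onD[OF conv]) auto
    moreover have "(1 - \<delta>) *\<^sub>R p + \<delta> *\<^sub>R q = p + \<delta> *\<^sub>R (q - p)" by (simp add: algebra_simps)
    ultimately show ?case using elim by (simp add: divide_simps algebra_simps)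
  qed
  then have "D \<le> f q - f p" by (intro tendsto_upperbound[OF D(1)]) auto
  then show "f p \<le> f q" using D(2) by simp
qed (rule \<open>p \<in> C\<close>)

lemma finite_d_stationary_values:
  assumes "finite I" "X = (\<Union>i\<in>I. C i)" and "\<And>i. i \<in> I \<Longrightarrow> convex_on (C i) f"
  shows "finite {f p | p. d_stationary f X p}"
proof (rule finite_subset)
  show "{f p | p. d_stationary f X p} \<subseteq> {f p | p. \<exists>i\<in>I. minimizes_on f (C i) p}"
  proof clarify
    fix p assume p: "d_stationary f X p"
    then obtain i where "i \<in> I" "p \<in> C i" using assms(2) by (auto simp: d_stationary_def)
    then have "minimizes_on f (C i) p"
      using p assms by (intro d_stationary_minimizes_on_convex_piece[of f X]) auto
    then show "\<exists>p'. f p = f p' \<and> (\<exists>i\<in>I. minimizes_on f (C i) p')" using \<open>i \<in> I\<close> by blast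
  qed
qed (rule finite_minimum_values[OF assms(1)])

lemma d_stationary_imp_local_minimizer:
  assumes "finite I" "X = (\<Union>i\<in>I. C i)" and "\<And>i. i \<in> I \<Longrightarrow> convex_on (C i) f"
    and closed: "\<And>i. i \<in> I \<Longrightarrow> closed (C i)" and p: "d_stationary f X p"
  shows "local_minimizer f X p"
proof -
  define K where "K = (\<Union>i\<in>{i\<in>I. p \<notin> C i}. C i)"
  have "closed K" unfolding K_def using assms(1) closed by (intro closed_UN) auto
  moreover have "p \<notin> K" by (auto simp: K_def)
  ultimately obtain e where e: "e > 0" "ball p e \<subseteq> - K"
    by (metis Compl_iff open_Compl open_contains_ball)
  have "f p \<le> f q" if q: "q \<in> X" "dist q p < e" for q
  proof -
    have "q \<notin> K" using e q by (auto simp: dist_commute)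
    then obtain i where i: "i \<in> I" "p \<in> C i" "q \<in> C i" using q assms(2) by (auto simp: K_def)
    then have "minimizes_on f (C i) p"
      using p assms by (intro d_stationary_minimizes_on_convex_piece[of f X]) auto
    then show ?thesis using i by (auto simp: minimizes_on_def)
  qed
  then show ?thesis using p e(1) by (auto simp: local_minimizer_def d_stationary_def)
qed

section \<open>The cells of the piecewise affine regression problem\<close>

text \<open>The vectors that represent \<open>\<Theta> \<mapsto> (a\<^sup>i)\<^sup>T u + \<alpha>\<^sub>i\<close> and \<open>\<Theta> \<mapsto> (b\<^sup>j)\<^sup>T u + \<beta>\<^sub>j\<close> as inner products
  on the parameter space.\<close>

definition piece1 :: "'k1 \<Rightarrow> real ^ 'd \<Rightarrow> ('d::finite, 'k1::finite, 'k2::finite) pa_params" where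
  "piece1 i u = (axis i (u, 1), 0)"

definition piece2 :: "'k2 \<Rightarrow> real ^ 'd \<Rightarrow> ('d::finite, 'k1::finite, 'k2::finite) pa_params" where
  "piece2 j u = (0, axis j (u, 1))"

lemma inner_piece1: "piece1 i u \<bullet> \<Theta> = fst (fst \<Theta> $ i) \<bullet> u + snd (fst \<Theta> $ i)"
  by (subst inner_commute) (simp add: piece1_def inner_prod_def inner_axis)

lemma inner_piece2: "piece2 j u \<bullet> \<Theta> = fst (snd \<Theta> $ j) \<bullet> u + snd (snd \<Theta> $ j)"
  by (subst inner_commute) (simp add: piece2_def inner_prod_def inner_axis)

definition active_cell ::
  "'l set \<Rightarrow> ('l \<Rightarrow> real ^ 'd) \<Rightarrow> ('l \<Rightarrow> 'k1) \<times> ('l \<Rightarrow> 'k2) \<Rightarrow> ('d::finite, 'k1::finite, 'k2::finite) pa_params set" where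
  "active_cell M x s = {\<Theta>. \<forall>l\<in>M.
     (\<forall>i. piece1 i (x l) \<bullet> \<Theta> \<le> piece1 (fst s l) (x l) \<bullet> \<Theta>) \<and>
     (\<forall>j. piece2 j (x l) \<bullet> \<Theta> \<le> piece2 (snd s l) (x l) \<bullet> \<Theta>)}"

lemma polyhedron_active_cell:
  fixes x :: "'l \<Rightarrow> real ^ 'd::finite" and s :: "('l \<Rightarrow> 'k1::finite) \<times> ('l \<Rightarrow> 'k2::finite)"
  assumes "finite M"
  shows "polyhedron (active_cell M x s)"
proof -
  define H1 where "H1 = (\<lambda>(l, i). {\<Theta> :: ('d, 'k1, 'k2) pa_params. (piece1 i (x l) - piece1 (fst s l) (x l)) \<bullet> \<Theta> \<le> 0}) ` (M \<times> UNIV)"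
  define H2 where "H2 = (\<lambda>(l, j). {\<Theta> :: ('d, 'k1, 'k2) pa_params. (piece2 j (x l) - piece2 (snd s l) (x l)) \<bullet> \<Theta> \<le> 0}) ` (M \<times> UNIV)"
  have "active_cell M x s = \<Inter>H1 \<inter> \<Inter>H2"
    by (auto simp: active_cell_def H1_def H2_def inner_diff_left)
  moreover have "polyhedron (\<Inter>H1)" "polyhedron (\<Inter>H2)"
    using assms by (auto simp: H1_def H2_def intro!: polyhedron_Inter polyhedron_halfspace_le)
  ultimately show ?thesis by simp
qed

lemma max_affine_eqI:
  assumes "\<And>j. fst (c $ j) \<bullet> u + snd (c $ j) \<le> fst (c $ i) \<bullet> u + snd (c $ i)"
  shows "max_affine c u = fst (c $ i) \<bullet> u + snd (c $ i)"
  unfolding max_affine_def using assms by (intro Max_eqI) auto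

lemma max_affine_attained:
  obtains i where "\<And>j. fst (c $ j) \<bullet> u + snd (c $ j) \<le> fst (c $ i) \<bullet> u + snd (c $ i)"
proof -
  let ?g = "\<lambda>i. fst (c $ i) \<bullet> u + snd (c $ i)"
  have "Max (range ?g) \<in> range ?g" by (intro Max_in) auto
  then obtain i where i: "Max (range ?g) = ?g i" by blast
  have "?g j \<le> ?g i" for j unfolding i[symmetric] by (intro Max_ge) auto
  then show ?thesis by (rule that)
qed

text \<open>The index functions are made extensional, i.e. fixed outside the samples, so that there are only
  finitely many of them.\<close>

lemma active_cells_cover:
  fixes M :: "'l set" and x :: "'l \<Rightarrow> real ^ 'd::finite"
  shows "(\<Union>s \<in> (M \<rightarrow>\<^sub>E (UNIV :: 'k1::finite set)) \<times> (M \<rightarrow>\<^sub>E (UNIV :: 'k2::finite set)). active_cell M x s) = UNIV"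
proof -
  have "\<exists>s \<in> (M \<rightarrow>\<^sub>E (UNIV :: 'k1 set)) \<times> (M \<rightarrow>\<^sub>E (UNIV :: 'k2 set)). \<Theta> \<in> active_cell M x s"
    for \<Theta> :: "('d, 'k1, 'k2) pa_params"
  proof -
    have "\<forall>l. \<exists>i. \<forall>j. piece1 j (x l) \<bullet> \<Theta> \<le> piece1 i (x l) \<bullet> \<Theta>"
      unfolding inner_piece1 using max_affine_attained by metis
    then obtain \<sigma> where \<sigma>: "\<And>l j. piece1 j (x l) \<bullet> \<Theta> \<le> piece1 (\<sigma> l) (x l) \<bullet> \<Theta>" by metis
    have "\<forall>l. \<exists>i. \<forall>j. piece2 j (x l) \<bullet> \<Theta> \<le> piece2 i (x l) \<bullet> \<Theta>"
      unfolding inner_piece2 using max_affine_attained by metis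
    then obtain \<tau> where \<tau>: "\<And>l j. piece2 j (x l) \<bullet> \<Theta> \<le> piece2 (\<tau> l) (x l) \<bullet> \<Theta>" by metis
    have "\<Theta> \<in> active_cell M x (restrict \<sigma> M, restrict \<tau> M)"
      using \<sigma> \<tau> by (simp add: active_cell_def)
    then show ?thesis
      by (intro bexI[of _ "(restrict \<sigma> M, restrict \<tau> M)"]) auto
  qed
  then show ?thesis by blast
qed

lemma pa_loss_on_active_cell:
  assumes "\<Theta> \<in> active_cell {1..N} x s"
  shows "pa_loss N x y \<Theta> =
    least_squares (1 / (2 * real N)) {1..N} y (\<lambda>l. piece1 (fst s l) (x l) - piece2 (snd s l) (x l)) \<Theta>"
proof -
  have "max_affine (fst \<Theta>) (x l) - max_affine (snd \<Theta>) (x l)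
      = (piece1 (fst s l) (x l) - piece2 (snd s l) (x l)) \<bullet> \<Theta>" if "l \<in> {1..N}" for l
  proof -
    have "max_affine (fst \<Theta>) (x l) = piece1 (fst s l) (x l) \<bullet> \<Theta>"
      using assms that unfolding active_cell_def inner_piece1 by (intro max_affine_eqI) auto
    moreover have "max_affine (snd \<Theta>) (x l) = piece2 (snd s l) (x l) \<bullet> \<Theta>"
      using assms that unfolding active_cell_def inner_piece2 by (intro max_affine_eqI) auto
    ultimately show ?thesis by (simp add: inner_diff_left)
  qed
  then show ?thesis by (simp add: pa_loss_def least_squares_def)
qed

theorem proposition16:
  fixes N :: nat
    and x :: "nat \<Rightarrow> real ^ 'd"
    and y :: "nat \<Rightarrow> real"
    and X :: "('d::finite, 'k1::finite, 'k2::finite) pa_params set"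
  assumes "N \<ge> 1" and "polyhedron X" and "X \<noteq> {}"
  shows "(\<exists>\<Theta>\<in>X. \<forall>\<Theta>'\<in>X. pa_loss N x y \<Theta> \<le> pa_loss N x y \<Theta>')
       \<and> finite {pa_loss N x y \<Theta> | \<Theta>. d_stationary (pa_loss N x y) X \<Theta>}
       \<and> (\<forall>\<Theta>. d_stationary (pa_loss N x y) X \<Theta> \<longrightarrow> local_minimizer (pa_loss N x y) X \<Theta>)"
proof -
  let ?f = "pa_loss N x y :: ('d, 'k1, 'k2) pa_params \<Rightarrow> real"
  define I where "I = ({1..N} \<rightarrow>\<^sub>E (UNIV :: 'k1 set)) \<times> ({1..N} \<rightarrow>\<^sub>E (UNIV :: 'k2 set))"
  define C where "C s = X \<inter> active_cell {1..N} x s" for s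
  define q where "q s = least_squares (1 / (2 * real N)) {1..N} y
      (\<lambda>l. piece1 (fst s l) (x l) - piece2 (snd s l) (x l) :: ('d, 'k1, 'k2) pa_params)" for s
  have finI: "finite I" by (simp add: I_def finite_PiE)
  have "(\<Union>s\<in>I. active_cell {1..N} x s) = UNIV"
    unfolding I_def by (rule active_cells_cover)
  then have cover: "X = (\<Union>s\<in>I. C s)" by (auto simp: C_def)
  have poly: "polyhedron (C s)" for s
    using assms(2) by (simp add: C_def polyhedron_active_cell)
  have fq: "?f \<Theta> = q s \<Theta>" if "\<Theta> \<in> C s" for s \<Theta>
    using that unfolding C_def q_def by (intro pa_loss_on_active_cell) blast
  have convq: "convex_on UNIV (q s)" for s
    by (simp add: q_def convex_on_least_squares)
  have convf: "convex_on (C s) ?f" for s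
  proof -
    have "convex (C s)" using poly by (rule polyhedron_imp_convex)
    then have "convex_on (C s) (q s)" using convex_on_subset[OF convq] by blast
    then show ?thesis using \<open>convex (C s)\<close> by (simp add: convex_on_def fq[of _ s] convexD)
  qed
  have cell_min: "\<exists>p. minimizes_on ?f (C s) p" if "C s \<noteq> {}" for s
  proof -
    have "\<exists>p. minimizes_on (q s) L p" if "affine L" "L \<noteq> {}" for L
      unfolding q_def using that by (intro least_squares_attains_on_affine) auto
    from convex_attains_on_polyhedron[OF poly \<open>C s \<noteq> {}\<close> convq this]
    obtain p where p: "minimizes_on (q s) (C s) p" by blast
    then have "?f p \<le> ?f r" if "r \<in> C s" for r
      using fq[of p s] fq[OF that] that by (simp add: minimizes_on_def)
    then show ?thesis using p unfolding minimizes_on_def by blast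
  qed
  have "\<exists>p. minimizes_on ?f X p"
  proof (rule attains_min_if_dominated_by_finite)
    let ?B = "{p. \<exists>s\<in>I. minimizes_on ?f (C s) p}"
    show "finite (?f ` ?B)" using finite_minimum_values[OF finI, of ?f C] by (simp add: image_Collect)
    show "?B \<subseteq> X" using cover by (auto simp: minimizes_on_def)
    show "\<exists>r\<in>?B. ?f r \<le> ?f p" if "p \<in> X" for p
    proof -
      obtain s where s: "s \<in> I" "p \<in> C s" using cover \<open>p \<in> X\<close> by blast
      then obtain r where r: "minimizes_on ?f (C s) r" using cell_min by blast
      then have "?f r \<le> ?f p" using s by (simp add: minimizes_on_def)
      then show ?thesis using r s by blast
    qed
  qed (rule assms(3))
  then have "\<exists>\<Theta>\<in>X. \<forall>\<Theta>'\<in>X. ?f \<Theta> \<le> ?f \<Theta>'" by (auto simp: minimizes_on_def)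
  moreover have "finite {?f \<Theta> | \<Theta>. d_stationary ?f X \<Theta>}"
    using finite_d_stationary_values[OF finI cover convf] .
  moreover have "\<forall>\<Theta>. d_stationary ?f X \<Theta> \<longrightarrow> local_minimizer ?f X \<Theta>"
    using d_stationary_imp_local_minimizer[OF finI cover convf polyhedron_imp_closed[OF poly]] by blast
  ultimately show ?thesis by blast
qed

end
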